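(* Let $r\ge2$ be an integer and $\gamma>0$. There exists $n_0=n_0(r,\gamma)\in\mathbb N$ such that the following holds for all $n\ge n_0$. Suppose $G$ is an $n$-vertex digraph such that for all distinct $x,y\in V(G)$ at least one of the following holds: (i) $xy,yx\in E(G)$; (ii) $d^*_G(z)\ge(1-1/r+\gamma)n$ for some $z\in\{x,y\}$. Then $G$ contains a $T_r$-tiling covering all but at most $\gamma n$ vertices of $G$.
   Context: Digraphs have no loops and at most one edge in each direction between any pair of vertices. The dominant degree of $z$ is $d^*_G(z):=\max\{d^+_G(z),d^-_G(z)\}$ (max of out-degree and in-degree). $T_r$ is the transitive tournament on $r$ vertices; a $T_r$-tiling is a collection of vertex-disjoint copies of $T_r$. *)

theory Defs
  imports Complex_Main "Graph_Theory.Graph_Theory"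
begin

(* Digraphs are modelled by the locale pair_digraph: finite and loop-free, with arcs given as a
   set of ordered pairs, hence at most one arc in each direction between two vertices. *)

definition dominant_degree :: "'a pair_pre_digraph \<Rightarrow> 'a \<Rightarrow> nat" where
  "dominant_degree G z = max (out_degree (with_proj G) z) (in_degree (with_proj G) z)"

definition transitive_tournament :: "nat \<Rightarrow> nat pair_pre_digraph" where
  "transitive_tournament r =
     \<lparr> pverts = {..<r}, parcs = {(i, j). i < j \<and> j < r} \<rparr>"

(* Copies are subgraphs that need not be induced. *)
definition copy_in :: "'b pair_pre_digraph \<Rightarrow> 'a pair_pre_digraph \<Rightarrow> 'a pair_pre_digraph \<Rightarrow> bool" where
  "copy_in F G H \<longleftrightarrow>
     subgraph (with_proj H) (with_proj G) \<and> digraph_iso (with_proj F) (with_proj H)"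

definition tiling :: "'b pair_pre_digraph \<Rightarrow> 'a pair_pre_digraph \<Rightarrow> 'a pair_pre_digraph set \<Rightarrow> bool" where
  "tiling F G \<T> \<longleftrightarrow>
     (\<forall>H\<in>\<T>. copy_in F G H) \<and>
     (\<forall>H\<in>\<T>. \<forall>H'\<in>\<T>. H \<noteq> H' \<longrightarrow> pverts H \<inter> pverts H' = {})"

end

theory Submission
  imports Defs "HOL-Library.Disjoint_Sets"
begin

text \<open>
  Fix for every vertex of large dominant degree one direction in which its degree is large; this
  gives a set \<open>P\<close> (large out-degree) and a set \<open>M\<close> (large in-degree), and all remaining vertices are
  joined by double edges. Call a transitive tournament coherent if no vertex of \<open>M\<close> precedes a
  vertex of \<open>P\<close>. Among all families of disjoint coherent tournaments on at most \<open>r\<close> vertices take one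
  maximising the sum of \<open>(2 * r) ^ card K\<close> over its members \<open>K\<close>. It covers every vertex. Fewer than \<open>r\<close>
  members of size less than \<open>r\<close> contain a vertex outside \<open>P \<union> M\<close>, as \<open>r\<close> such vertices form a copy
  of \<open>T\<^sub>r\<close>. A member \<open>A \<subseteq> P \<union> M\<close> of size less than \<open>r\<close> sends, by averaging, more than
  \<open>(1 - 1/r) * card A * card K\<close> edges of the chosen directions to at least \<open>\<gamma> * n\<close> members \<open>K\<close>. Then
  some \<open>x \<in> A\<close> dominates \<open>K\<close>, and some \<open>v \<in> K\<close> is dominated by all of \<open>A\<close>; this forces
  \<open>card K = r\<close>, for otherwise \<open>x\<close> could be added to \<open>K\<close>, or \<open>v\<close> to \<open>A\<close>. If \<open>A\<close> and a further such \<open>B\<close>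
  share the same \<open>K\<close>, replacing \<open>v\<close> by \<open>x\<close> in \<open>K\<close> and adding \<open>v\<close> to \<open>B\<close> increases the weight. Hence
  there are at most \<open>1 / \<gamma>\<close> such members \<open>A\<close>, and only boundedly many vertices stay uncovered.
\<close>

section \<open>Chosen directions and coherent tournaments\<close>

locale dominated_digraph =
  fixes V :: "'a set" and E :: "'a rel" and P M :: "'a set" and r :: nat and \<gamma> :: real
  assumes finite_V: "finite V"
    and irrefl: "(x, x) \<notin> E"
    and PM: "P \<inter> M = {}"
    and complete: "\<lbrakk>x \<in> V - (P \<union> M); y \<in> V - (P \<union> M); x \<noteq> y\<rbrakk> \<Longrightarrow> (x, y) \<in> E"
    and r: "r \<ge> 2"
    and \<gamma>: "\<gamma> > 0"
begin

text \<open>The neighbourhood in the chosen direction; it is empty for vertices outside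
  \<open>P \<union> M\<close>.\<close>

definition N :: "'a \<Rightarrow> 'a set" where
  "N x = {v \<in> V. x \<in> P \<and> (x, v) \<in> E \<or> x \<in> M \<and> (v, x) \<in> E}"

text \<open>Coherence constrains pairs only, so it is built into the edge relation and
  \<open>sorted_wrt R\<close> expresses both demands at once.\<close>

definition R :: "'a \<Rightarrow> 'a \<Rightarrow> bool" where
  "R x y \<longleftrightarrow> (x, y) \<in> E \<and> \<not> (x \<in> M \<and> y \<in> P)"

definition coherent :: "'a set \<Rightarrow> bool" where
  "coherent K \<longleftrightarrow> (\<exists>xs. set xs = K \<and> sorted_wrt R xs)"

lemma R_irrefl: "\<not> R x x"
  using irrefl by (simp add: R_def)

lemma not_in_N: "x \<notin> N x"
  using irrefl by (simp add: N_def)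

lemma sorted_wrt_R_distinct: "sorted_wrt R xs \<Longrightarrow> distinct xs"
  using R_irrefl by (induction xs) auto

lemma coherent_subset:
  assumes "coherent K" "J \<subseteq> K"
  shows "coherent J"
proof -
  obtain xs where "set xs = K" "sorted_wrt R xs"
    using assms by (auto simp: coherent_def)
  then show ?thesis
    using assms(2) unfolding coherent_def
    by (intro exI[of _ "filter (\<lambda>x. x \<in> J) xs"]) (auto intro: sorted_wrt_filter)
qed

text \<open>A vertex of \<open>P\<close> goes to the front and a vertex of \<open>M\<close> to the
  end, so no vertex of \<open>M\<close> comes to precede one of \<open>P\<close>.\<close>

lemma coherent_insert_outer:
  assumes "coherent K" "x \<in> P \<union> M" "K \<subseteq> N x"
  shows "coherent (insert x K)"
proof -
  obtain xs where xs: "set xs = K" "sorted_wrt R xs"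
    using assms by (auto simp: coherent_def)
  show ?thesis
  proof (cases "x \<in> P")
    case True
    then have "sorted_wrt R (x # xs)"
      using xs assms PM by (auto simp: R_def N_def)
    then show ?thesis
      using xs unfolding coherent_def by (intro exI[of _ "x # xs"]) auto
  next
    case False
    then have "sorted_wrt R (xs @ [x])"
      using xs assms PM by (auto simp: R_def N_def sorted_wrt_append)
    then show ?thesis
      using xs unfolding coherent_def by (intro exI[of _ "xs @ [x]"]) auto
  qed
qed

lemma sorted_wrt_R_total:
  "\<lbrakk>sorted_wrt R xs; x \<in> set xs; y \<in> set xs; x \<noteq> y\<rbrakk> \<Longrightarrow> R x y \<or> R y x"
  by (induction xs) auto

text \<open>The new vertex goes between the vertices of \<open>P\<close> and those of \<open>M\<close>, so its own type is
  irrelevant.\<close>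

lemma coherent_insert_middle:
  assumes "coherent A" "A \<subseteq> P \<union> M" "\<And>y. y \<in> A \<Longrightarrow> v \<in> N y"
  shows "coherent (insert v A)"
proof -
  obtain xs where xs: "set xs = A" "sorted_wrt R xs"
    using assms by (auto simp: coherent_def)
  let ?ys = "filter (\<lambda>x. x \<in> P) xs @ v # filter (\<lambda>x. x \<in> M) xs"
  \<comment> \<open>The two vertices are comparable, and coherence rules out
    \<open>R m p\<close>.\<close>
  have "R p m" if "p \<in> P" "m \<in> M" "p \<in> A" "m \<in> A" for p m
    using sorted_wrt_R_total[OF xs(2), of p m] that xs(1) PM by (auto simp: R_def)
  moreover have "R p v" if "p \<in> P" "p \<in> A" for p
    using assms(3)[OF that(2)] that PM by (auto simp: R_def N_def)
  moreover have "R v m" if "m \<in> M" "m \<in> A" for m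
    using assms(3)[OF that(2)] that PM by (auto simp: R_def N_def)
  ultimately have "sorted_wrt R ?ys"
    using xs by (auto simp: sorted_wrt_append intro: sorted_wrt_filter)
  moreover have "set ?ys = insert v A"
    using xs(1) assms(2) by auto
  ultimately show ?thesis
    unfolding coherent_def by blast
qed

lemma coherent_complete:
  assumes "K \<subseteq> V - (P \<union> M)"
  shows "coherent K"
proof -
  have "finite K" using assms finite_V by (meson finite_Diff finite_subset)
  then obtain xs where xs: "set xs = K" "distinct xs"
    using finite_distinct_list by blast
  have "sorted_wrt R ys" if "distinct ys" "set ys \<subseteq> V - (P \<union> M)" for ys
    using that by (induction ys) (auto simp: R_def intro: complete)
  then show ?thesis
    using xs assms unfolding coherent_def by blast
qed

lemma coherent_singleton: "coherent {v}"
  unfolding coherent_def by (intro exI[of _ "[v]"]) auto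

section \<open>Partial tilings of maximum weight\<close>

definition partial_tiling :: "'a set set \<Rightarrow> bool" where
  "partial_tiling \<K> \<longleftrightarrow> disjoint \<K> \<and>
     (\<forall>K\<in>\<K>. K \<subseteq> V \<and> coherent K \<and> 0 < card K \<and> card K \<le> r)"

text \<open>The base \<open>2 * r\<close> is large enough that one piece of size
  \<open>a + 1\<close> outweighs two pieces of size at most \<open>a\<close>, and also
  \<open>r\<close> of them.\<close>

definition weight :: "'a set set \<Rightarrow> nat" where
  "weight \<K> = (\<Sum>K\<in>\<K>. (2 * r) ^ card K)"

lemma finite_partial_tiling: "partial_tiling \<K> \<Longrightarrow> finite \<K>"
  using finite_V unfolding partial_tiling_def
  by (meson PowI finite_Pow_iff finite_subset subsetI)

lemma heaviest_partial_tiling: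
  obtains \<K> where "partial_tiling \<K>" "\<And>\<L>. partial_tiling \<L> \<Longrightarrow> weight \<L> \<le> weight \<K>"
proof -
  let ?C = "{\<K>. partial_tiling \<K>}"
  have "?C \<subseteq> Pow (Pow V)"
    by (auto simp: partial_tiling_def)
  then have fin: "finite (weight ` ?C)"
    using finite_V by (meson finite_Pow_iff finite_imageI finite_subset)
  have "{} \<in> ?C"
    by (simp add: partial_tiling_def)
  then have "Max (weight ` ?C) \<in> weight ` ?C"
    using fin by (intro Max_in) blast+
  then obtain \<K> where "partial_tiling \<K>" "weight \<K> = Max (weight ` ?C)"
    by auto
  then show thesis
    using that[of \<K>] fin by simp
qed

end

locale heaviest_tiling = dominated_digraph +
  fixes \<K> :: "'a set set"
  assumes tiling: "partial_tiling \<K>"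
    and heaviest: "\<And>\<L>. partial_tiling \<L> \<Longrightarrow> weight \<L> \<le> weight \<K>"
begin

lemma piece:
  assumes "K \<in> \<K>"
  shows "K \<subseteq> V" "coherent K" "0 < card K" "card K \<le> r" "finite K"
  using assms tiling finite_V finite_subset by (auto simp: partial_tiling_def)

lemma finite_\<K>: "finite \<K>"
  using tiling by (rule finite_partial_tiling)

lemma pieces_disjoint: "\<lbrakk>K \<in> \<K>; L \<in> \<K>; x \<in> K; x \<in> L\<rbrakk> \<Longrightarrow> K = L"
  using tiling by (auto simp: partial_tiling_def disjoint_def)

text \<open>The members of \<open>\<D>\<close> are dissolved and their vertices reused for \<open>\<N>\<close>; vertices may be left over.\<close>

lemma exchange:
  assumes "\<D> \<subseteq> \<K>" and "partial_tiling \<N>" and "\<Union>\<N> \<subseteq> \<Union>\<D> \<union> (V - \<Union>\<K>)"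
  shows "weight \<N> \<le> weight \<D>"
proof -
  have sep: "x \<notin> L" if "x \<in> K" "K \<in> \<N>" "L \<in> \<K> - \<D>" for x K L
    using that assms(1,3) pieces_disjoint by blast
  have "partial_tiling ((\<K> - \<D>) \<union> \<N>)"
  proof -
    have "disjoint ((\<K> - \<D>) \<union> \<N>)"
    proof (rule disjoint_union)
      show "disjoint (\<K> - \<D>)" "disjoint \<N>"
        using tiling assms(2) by (auto simp: partial_tiling_def disjoint_def)
      show "\<Union>(\<K> - \<D>) \<inter> \<Union>\<N> = {}"
        using sep by blast
    qed
    then show ?thesis
      using tiling assms(2) by (auto simp: partial_tiling_def)
  qed
  then have "weight ((\<K> - \<D>) \<union> \<N>) \<le> weight \<K>"
    by (rule heaviest)
  \<comment> \<open>Disjointness of the unions would still allow a common empty member; pieces are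
    nonempty, so the weights add up.\<close>
  moreover have "(\<K> - \<D>) \<inter> \<N> = {}"
  proof -
    have False if "K \<in> \<K> - \<D>" "K \<in> \<N>" for K
    proof -
      have "K \<noteq> {}" using piece(3) that(1) by fastforce
      then show False using sep that by blast
    qed
    then show ?thesis by blast
  qed
  then have "weight ((\<K> - \<D>) \<union> \<N>) = weight (\<K> - \<D>) + weight \<N>"
    unfolding weight_def using finite_\<K> finite_partial_tiling[OF assms(2)]
    by (intro sum.union_disjoint) auto
  moreover have "weight \<K> = weight (\<K> - \<D>) + weight \<D>"
    unfolding weight_def using finite_\<K> assms(1) by (intro sum.subset_diff)
  ultimately show ?thesis by linarith
qed

lemma partial_tiling_single:
  "\<lbrakk>K \<subseteq> V; coherent K; 0 < card K; card K \<le> r\<rbrakk> \<Longrightarrow> partial_tiling {K}"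
  by (simp add: partial_tiling_def)

lemma pow_less:
  assumes "s \<le> a" "t \<le> a"
  shows "(2 * r) ^ s + (2 * r) ^ t < (2 * r) ^ Suc a"
proof -
  define m where "m = 2 * r"
  have m: "m \<ge> 4" using r by (simp add: m_def)
  then have "m ^ s \<le> m ^ a" "m ^ t \<le> m ^ a" "4 * m ^ a \<le> m ^ Suc a" "m ^ a > 0"
    using assms by (auto intro!: power_increasing)
  then show ?thesis unfolding m_def by linarith
qed

text \<open>An uncovered vertex could be added as a singleton piece without dissolving
  anything.\<close>

lemma Union_\<K>: "\<Union>\<K> = V"
proof (rule ccontr)
  assume "\<Union>\<K> \<noteq> V"
  then obtain v where v: "v \<in> V - \<Union>\<K>"
    using piece(1) by blast
  then have "weight {{v}} \<le> weight {}"
    using r by (intro exchange partial_tiling_single) (auto simp: coherent_singleton)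
  then show False
    using r by (simp add: weight_def)
qed

lemma sum_card_Int:
  assumes "X \<subseteq> V"
  shows "(\<Sum>K\<in>\<K>. card (X \<inter> K)) = card X"
proof -
  have "card X = card (\<Union>K\<in>\<K>. X \<inter> K)"
    using Union_\<K> assms by (intro arg_cong[where f = card]) blast
  also have "\<dots> = (\<Sum>K\<in>\<K>. card (X \<inter> K))"
    using finite_\<K> piece(5) pieces_disjoint by (intro card_UN_disjoint) auto
  finally show ?thesis by simp
qed

lemma card_incomplete_meeting_complete:
  "card {K \<in> \<K>. card K < r \<and> \<not> K \<subseteq> P \<union> M} < r" (is "card ?F < r")
proof (rule ccontr)
  assume "\<not> ?thesis"
  then obtain \<F> where \<F>: "\<F> \<subseteq> ?F" "card \<F> = r" "finite \<F>"
    by (meson not_less obtain_subset_with_card_n)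
  have "\<exists>x. x \<in> K \<and> x \<notin> P \<union> M" if "K \<in> \<F>" for K
    using \<F> that by blast
  then obtain f where f: "\<And>K. K \<in> \<F> \<Longrightarrow> f K \<in> K \<and> f K \<notin> P \<union> M"
    by metis
  have "inj_on f \<F>"
    using f \<F>(1) by (intro inj_onI) (metis (no_types, lifting) mem_Collect_eq pieces_disjoint subsetD)
  then have card: "card (f ` \<F>) = r"
    using \<F>(2) by (simp add: card_image)
  have sub: "f ` \<F> \<subseteq> V - (P \<union> M)"
    using f \<F>(1) piece(1) by blast
  have "weight {f ` \<F>} \<le> weight \<F>"
  proof (rule exchange)
    show "\<F> \<subseteq> \<K>" using \<F> by blast
    show "partial_tiling {f ` \<F>}"
      using sub card r by (intro partial_tiling_single coherent_complete) auto
    show "\<Union> {f ` \<F>} \<subseteq> \<Union> \<F> \<union> (V - \<Union> \<K>)" using f by blast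
  qed
  moreover have "weight {f ` \<F>} = (2 * r) ^ r"
    using card by (simp add: weight_def)
  moreover have "weight \<F> \<le> (\<Sum>K\<in>\<F>. (2 * r) ^ (r - 1))"
    unfolding weight_def using \<F>(1) r by (intro sum_mono power_increasing) auto
  moreover have "(\<Sum>K\<in>\<F>. (2 * r) ^ (r - 1)) = r * (2 * r) ^ (r - 1)"
    using \<F>(2) by simp
  \<comment> \<open>The new full piece weighs twice the upper bound for the \<open>r\<close>
    dissolved ones.\<close>
  moreover have "(2 * r) ^ r = 2 * (r * (2 * r) ^ (r - 1))"
    using r by (simp add: power_eq_if)
  moreover have "r * (2 * r) ^ (r - 1) > 0" using r by simp
  ultimately show False by linarith
qed

section \<open>Edge density between two pieces\<close>

definition density :: "'a set \<Rightarrow> 'a set \<Rightarrow> nat" where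
  "density A K = (\<Sum>x\<in>A. card (N x \<inter> K))"

lemma dominating_vertex_exists:
  assumes "finite K" "density A K > card A * (card K - 1)"
  obtains x where "x \<in> A" "K \<subseteq> N x"
proof -
  have "\<exists>x\<in>A. card (N x \<inter> K) > card K - 1"
  proof (rule ccontr)
    assume "\<not> ?thesis"
    then have "density A K \<le> (\<Sum>x\<in>A. card K - 1)"
      unfolding density_def by (intro sum_mono) force
    with assms(2) show False by simp
  qed
  then obtain x where x: "x \<in> A" "card (N x \<inter> K) > card K - 1" by blast
  then have "N x \<inter> K = K"
    using assms(1) by (intro card_seteq) auto
  with x that show thesis by blast
qed

lemma density_swap:
  assumes "finite A" "finite K"
  shows "density A K = (\<Sum>v\<in>K. card {x \<in> A. v \<in> N x})"
proof -
  have "density A K = (\<Sum>x\<in>A. \<Sum>v\<in>K. if v \<in> N x then 1 else 0)"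
    unfolding density_def using assms
    by (intro sum.cong refl) (simp add: sum.If_cases Int_def conj_commute)
  also have "\<dots> = (\<Sum>v\<in>K. \<Sum>x\<in>A. if v \<in> N x then 1 else 0)"
    by (rule sum.swap)
  also have "\<dots> = (\<Sum>v\<in>K. card {x \<in> A. v \<in> N x})"
    using assms by (intro sum.cong refl) (simp add: sum.If_cases Int_def)
  finally show ?thesis .
qed

lemma common_neighbour_exists:
  assumes "finite A" "finite K" "density A K > card K * (card A - 1)"
  obtains v where "v \<in> K" "\<And>x. x \<in> A \<Longrightarrow> v \<in> N x"
proof -
  have "\<exists>v\<in>K. card {x \<in> A. v \<in> N x} > card A - 1"
  proof (rule ccontr)
    assume "\<not> ?thesis"
    then have "(\<Sum>v\<in>K. card {x \<in> A. v \<in> N x}) \<le> (\<Sum>v\<in>K. card A - 1)"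
      by (intro sum_mono) force
    with assms density_swap show False by simp
  qed
  then obtain v where v: "v \<in> K" "card {x \<in> A. v \<in> N x} > card A - 1" by blast
  then have "{x \<in> A. v \<in> N x} = A"
    using assms(1) by (intro card_seteq) auto
  with v that show thesis by blast
qed

text \<open>The condition \<open>density A K > (1 - 1/r) * card A * card K\<close>, cleared of denominators.\<close>

definition good :: "'a set \<Rightarrow> 'a set \<Rightarrow> bool" where
  "good A K \<longleftrightarrow> r * density A K > (r - 1) * (card A * card K)"

text \<open>Averaging over \<open>A\<close> yields a dominating vertex above density
  \<open>1 - 1 / card K\<close>, which is at most \<open>1 - 1/r\<close> since
  \<open>card K \<le> r\<close>.\<close>

lemma good_dominating:
  assumes "good A K" "card K \<le> r"
  shows "density A K > card A * (card K - 1)"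
proof -
  have "r * (card K - 1) \<le> (r - 1) * card K"
    using assms(2) r by (simp add: diff_mult_distrib diff_mult_distrib2)
  then have "r * (card A * (card K - 1)) \<le> (r - 1) * (card A * card K)"
    by (metis mult.left_commute mult_le_mono2)
  with assms(1) have "r * (card A * (card K - 1)) < r * density A K"
    unfolding good_def by linarith
  then show ?thesis by simp
qed

text \<open>The same comparison for averaging over \<open>K\<close>, where the threshold is
  \<open>1 - 1 / card A\<close>.\<close>

lemma good_common:
  assumes "good A K" "card A \<le> r"
  shows "density A K > card K * (card A - 1)"
proof -
  have "r * (card A - 1) \<le> (r - 1) * card A"
    using assms(2) r by (simp add: diff_mult_distrib diff_mult_distrib2)
  then have "r * (card K * (card A - 1)) \<le> (r - 1) * (card A * card K)"
    by (metis mult.left_commute mult_le_mono2 mult.commute)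
  with assms(1) have "r * (card K * (card A - 1)) < r * density A K"
    unfolding good_def by linarith
  then show ?thesis by simp
qed

text \<open>A vertex of \<open>A\<close> dominating all of \<open>A\<close> would be its own
  neighbour.\<close>

lemma good_imp_neq:
  assumes "good A K" "A \<in> \<K>"
  shows "K \<noteq> A"
proof
  assume "K = A"
  then obtain x where "x \<in> A" "A \<subseteq> N x"
    using assms good_dominating piece(4,5) dominating_vertex_exists by metis
  then show False using not_in_N by blast
qed

section \<open>Exchanges along good pairs\<close>

lemma good_imp_full:
  assumes A: "A \<in> \<K>" "A \<subseteq> P \<union> M" "card A < r" and K: "K \<in> \<K>" and "good A K"
  shows "card K = r"
proof (rule ccontr)
  assume "card K \<noteq> r"
  then have lt: "card K < r" using piece(4)[OF K] by simp
  have neq: "K \<noteq> A" using good_imp_neq assms by blast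
  then have disj: "x \<notin> K" if "x \<in> A" for x
    using pieces_disjoint A(1) K that by blast
  have wD: "weight {A, K} = (2 * r) ^ card A + (2 * r) ^ card K"
    using neq by (simp add: weight_def)
  show False
  \<comment> \<open>The larger of the two pieces takes one vertex from the other, whose remaining
    vertices are given up; \<open>pow_less\<close> shows that the weight still increases.\<close>
  proof (cases "card A \<le> card K")
    case True
    obtain x where x: "x \<in> A" "K \<subseteq> N x"
      using dominating_vertex_exists[OF piece(5)[OF K] good_dominating[OF \<open>good A K\<close>]] lt by auto
    have c: "card (insert x K) = Suc (card K)"
      using disj[OF x(1)] piece(5)[OF K] by simp
    have "weight {insert x K} \<le> weight {A, K}"
    proof (rule exchange)
      show "{A, K} \<subseteq> \<K>" using A K by simp
      show "partial_tiling {insert x K}"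
        using x c lt piece[OF K] piece(1)[OF A(1)] A(2)
        by (intro partial_tiling_single coherent_insert_outer) auto
    qed (use x in auto)
    then show False
      using c wD pow_less[OF True le_refl] by (simp add: weight_def)
  next
    case False
    obtain v where v: "v \<in> K" "\<And>y. y \<in> A \<Longrightarrow> v \<in> N y"
      using common_neighbour_exists[OF piece(5)[OF A(1)] piece(5)[OF K] good_common[OF \<open>good A K\<close>]]
        A(3) by auto
    have c: "card (insert v A) = Suc (card A)"
      using disj v(1) piece(5)[OF A(1)] by (metis card_insert_disjoint)
    have "weight {insert v A} \<le> weight {A, K}"
    proof (rule exchange)
      show "{A, K} \<subseteq> \<K>" using A K by simp
      show "partial_tiling {insert v A}"
        using v c A(2,3) piece[OF A(1)] piece(1)[OF K]
        by (intro partial_tiling_single coherent_insert_middle) auto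
    qed (use v in auto)
    then show False
      using c wD pow_less[of "card A" "card A" "card K"] False by (simp add: weight_def)
  qed
qed

lemma good_not_shared_aux:
  assumes A: "A \<in> \<K>" "A \<subseteq> P \<union> M" "card A < r" and B: "B \<in> \<K>" "B \<subseteq> P \<union> M" "card B < r"
    and K: "K \<in> \<K>" and good: "good A K" "good B K" and "A \<noteq> B" "card A \<le> card B"
  shows False
proof -
  have neq: "K \<noteq> A" "K \<noteq> B" using good_imp_neq A B good by blast+
  have full: "card K = r" using good_imp_full A K good by blast
  have disj: "A \<inter> B = {}" "A \<inter> K = {}" "B \<inter> K = {}"
    using pieces_disjoint A(1) B(1) K neq \<open>A \<noteq> B\<close> by blast+
  obtain x where x: "x \<in> A" "K \<subseteq> N x"
    using dominating_vertex_exists[OF piece(5)[OF K] good_dominating[OF good(1)]] full by auto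
  obtain v where v: "v \<in> K" "\<And>y. y \<in> B \<Longrightarrow> v \<in> N y"
    using common_neighbour_exists[OF piece(5)[OF B(1)] piece(5)[OF K] good_common[OF good(2)]]
      B(3) by auto
  \<comment> \<open>\<open>K\<close> keeps its size, \<open>B\<close> grows by one, and the rest of
    \<open>A\<close> is given up; since \<open>card A \<le> card B\<close>, the growth of
    \<open>B\<close> outweighs this loss.\<close>
  let ?K = "insert x (K - {v})" and ?B = "insert v B"
  have cK: "card ?K = r"
    using x v disj full piece(5)[OF K] r by (subst card_insert_disjoint) auto
  have cB: "card ?B = Suc (card B)"
    using v disj piece(5)[OF B(1)] by (intro card_insert_disjoint) auto
  have sep: "?K \<inter> ?B = {}"
    using x v disj by auto
  have "weight {?K, ?B} \<le> weight {A, B, K}"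
  proof (rule exchange)
    show "{A, B, K} \<subseteq> \<K>" using A B K by simp
    have "coherent ?K"
      using x A(2) coherent_subset[OF piece(2)[OF K]] by (intro coherent_insert_outer) auto
    moreover have "coherent ?B"
      using v B(2) piece(2)[OF B(1)] by (intro coherent_insert_middle) auto
    moreover have "?K \<subseteq> V" "?B \<subseteq> V"
      using x v piece(1)[OF A(1)] piece(1)[OF B(1)] piece(1)[OF K] by auto
    ultimately show "partial_tiling {?K, ?B}"
      using cK cB sep B(3) r by (auto simp: partial_tiling_def disjoint_def)
  qed (use x v in auto)
  moreover have "weight {A, B, K} = (2 * r) ^ card A + ((2 * r) ^ card B + (2 * r) ^ r)"
    using neq \<open>A \<noteq> B\<close> full by (simp add: weight_def)
  moreover have "?K \<noteq> ?B"
    using sep by blast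
  then have "weight {?K, ?B} = (2 * r) ^ r + (2 * r) ^ Suc (card B)"
    unfolding weight_def using cK cB by simp
  ultimately show False
    using pow_less[OF \<open>card A \<le> card B\<close> le_refl] by linarith
qed

section \<open>Counting incomplete pieces and uncovered vertices\<close>

definition leftover :: "'a set set" where
  "leftover = {K \<in> \<K>. card K < r \<and> K \<subseteq> P \<union> M}"

lemma good_not_shared:
  assumes "A \<in> leftover" "B \<in> leftover" "K \<in> \<K>" "good A K" "good B K"
  shows "A = B"
  using assms good_not_shared_aux[of A B K] good_not_shared_aux[of B A K]
  unfolding leftover_def by (cases "card A \<le> card B") auto

text \<open>The edges from \<open>A\<close> in the chosen directions are counted piece by piece.
  Each good piece exceeds \<open>(1 - 1/r) * card A * card K\<close> by at most
  \<open>card A\<close>, the others not at all, while the total excess is at least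
  \<open>\<gamma> * card V * card A\<close>.\<close>

lemma many_good:
  assumes A: "A \<in> leftover"
    and deg: "\<And>x. x \<in> A \<Longrightarrow> (1 - 1 / real r + \<gamma>) * real (card V) \<le> real (card (N x))"
  shows "\<gamma> * real (card V) \<le> real (card {K \<in> \<K>. good A K})"
proof -
  let ?a = "real (card A)" and ?n = "real (card V)" and ?G = "{K \<in> \<K>. good A K}"
  have A': "A \<in> \<K>" using A by (simp add: leftover_def)
  have a: "?a > 0" using piece(3)[OF A'] by simp
  have "?a * ((1 - 1 / real r + \<gamma>) * ?n) \<le> (\<Sum>x\<in>A. real (card (N x)))"
    using sum_mono[of A "\<lambda>_. (1 - 1 / real r + \<gamma>) * ?n", OF deg] by simp
  also have "\<dots> = (\<Sum>x\<in>A. \<Sum>K\<in>\<K>. real (card (N x \<inter> K)))"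
    using sum_card_Int[of "N _"] by (intro sum.cong refl) (simp add: N_def flip: of_nat_sum)
  also have "\<dots> = (\<Sum>K\<in>\<K>. real (density A K))"
    by (subst sum.swap) (simp add: density_def)
  also have "\<dots> \<le> (\<Sum>K\<in>\<K>. (1 - 1 / real r) * ?a * real (card K) + (if good A K then ?a else 0))"
  proof (rule sum_mono)
    fix K assume K: "K \<in> \<K>"
    show "real (density A K) \<le> (1 - 1 / real r) * ?a * real (card K) + (if good A K then ?a else 0)"
    proof (cases "good A K")
      case True
      have "density A K \<le> (\<Sum>x\<in>A. card K)"
        unfolding density_def using piece(5)[OF K] by (intro sum_mono card_mono) auto
      then have "real (density A K) \<le> ?a * real (card K)"
        by (simp flip: of_nat_mult)
      \<comment> \<open>This is where \<open>card K \<le> r\<close> caps the excess of a good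
        piece.\<close>
      moreover have "?a * real (card K) / real r \<le> ?a"
        using piece(4)[OF K] r a by (simp add: divide_simps mult_left_mono)
      ultimately show ?thesis
        using True by (simp add: algebra_simps)
    next
      case False
      then have "real (r * density A K) \<le> real ((r - 1) * (card A * card K))"
        unfolding good_def by (simp only: of_nat_le_iff not_less)
      then have "real r * real (density A K) \<le> (real r - 1) * (?a * real (card K))"
        using r by simp
      then show ?thesis
        using False r by (simp add: field_simps)
    qed
  qed
  also have "\<dots> = (1 - 1 / real r) * ?a * (\<Sum>K\<in>\<K>. real (card K)) + real (card ?G) * ?a"
    using finite_\<K> by (simp add: sum.distrib sum_distrib_left sum.If_cases Int_def)
  also have "(\<Sum>K\<in>\<K>. real (card K)) = ?n"
  proof -
    have "(\<Sum>K\<in>\<K>. card K) = (\<Sum>K\<in>\<K>. card (V \<inter> K))"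
      using piece(1) by (intro sum.cong refl arg_cong[where f = card]) blast
    then show ?thesis
      using sum_card_Int[of V] by (simp flip: of_nat_sum)
  qed
  finally have "?a * (\<gamma> * ?n) \<le> ?a * real (card ?G)"
    by (simp add: algebra_simps)
  then show ?thesis
    using a by simp
qed

lemma card_\<K>_le: "card \<K> \<le> card V"
proof -
  have "card \<K> = (\<Sum>K\<in>\<K>. 1)" by simp
  also have "\<dots> \<le> (\<Sum>K\<in>\<K>. card (V \<inter> K))"
    using piece(1,3) by (intro sum_mono) (simp add: Int_absorb1 Suc_leI)
  finally show ?thesis using sum_card_Int[of V] by simp
qed

text \<open>The sets of good partners are pairwise disjoint, each has at least
  \<open>\<gamma> * card V\<close> members, and there are at most \<open>card V\<close> pieces in
  all.\<close>

lemma card_leftover: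
  assumes deg: "\<And>x. x \<in> V \<inter> (P \<union> M) \<Longrightarrow> (1 - 1 / real r + \<gamma>) * real (card V) \<le> real (card (N x))"
    and "V \<noteq> {}"
  shows "real (card leftover) \<le> 1 / \<gamma>"
proof -
  let ?n = "real (card V)" and ?G = "\<lambda>A. {K \<in> \<K>. good A K}"
  have n: "?n > 0" using assms(2) finite_V by (simp add: card_gt_0_iff)
  have fin: "finite leftover" using finite_\<K> by (simp add: leftover_def)
  have "real (card leftover) * (\<gamma> * ?n) \<le> (\<Sum>A\<in>leftover. real (card (?G A)))"
  proof -
    have "\<gamma> * ?n \<le> real (card (?G A))" if "A \<in> leftover" for A
      using that piece(1) by (intro many_good deg) (auto simp: leftover_def)
    then show ?thesis
      using sum_mono[of leftover "\<lambda>_. \<gamma> * ?n"] by simp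
  qed
  also have "\<dots> = real (card (\<Union>A\<in>leftover. ?G A))"
    using fin finite_\<K> good_not_shared by (subst card_UN_disjoint) auto
  also have "\<dots> \<le> real (card \<K>)"
    using finite_\<K> by (intro of_nat_mono card_mono) auto
  also have "\<dots> \<le> ?n"
    using card_\<K>_le by simp
  finally have "(real (card leftover) * \<gamma>) * ?n \<le> 1 * ?n" by simp
  then have "real (card leftover) * \<gamma> \<le> 1"
    using n by simp
  then show ?thesis
    using \<gamma> by (simp add: field_simps)
qed

lemma card_uncovered:
  assumes deg: "\<And>x. x \<in> V \<inter> (P \<union> M) \<Longrightarrow> (1 - 1 / real r + \<gamma>) * real (card V) \<le> real (card (N x))"
  shows "real (card (V - \<Union>{K \<in> \<K>. card K = r})) \<le> real r * (real r + 1 / \<gamma>)"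
proof (cases "V = {}")
  case True
  then show ?thesis using \<gamma> by simp
next
  case False
  let ?S = "{K \<in> \<K>. card K < r}" and ?F = "{K \<in> \<K>. card K < r \<and> \<not> K \<subseteq> P \<union> M}"
  have fin: "finite ?S" using finite_\<K> by simp
  have "V - \<Union>{K \<in> \<K>. card K = r} \<subseteq> \<Union>?S"
  proof
    fix x assume x: "x \<in> V - \<Union>{K \<in> \<K>. card K = r}"
    then obtain K where "K \<in> \<K>" "x \<in> K" using Union_\<K> by blast
    then show "x \<in> \<Union>?S" using x piece(4)[of K] by force
  qed
  then have "card (V - \<Union>{K \<in> \<K>. card K = r}) \<le> card (\<Union>?S)"
    using fin piece(5) by (intro card_mono) auto
  also have "\<dots> \<le> (\<Sum>K\<in>?S. card K)"
    by (rule card_Union_le_sum_card)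
  also have "\<dots> \<le> card ?S * r"
    using sum_bounded_above[of ?S card r] by auto
  also have "?S = ?F \<union> leftover"
    by (auto simp: leftover_def)
  also have "card (?F \<union> leftover) * r \<le> (r + card leftover) * r"
    using card_Un_le[of ?F leftover] card_incomplete_meeting_complete by (intro mult_le_mono1) linarith
  finally have "real (card (V - \<Union>{K \<in> \<K>. card K = r})) \<le> real ((r + card leftover) * r)"
    by (rule of_nat_mono)
  also have "\<dots> \<le> real r * (real r + 1 / \<gamma>)"
    using card_leftover[OF deg False] by (simp add: mult.commute mult_left_mono)
  finally show ?thesis .
qed

end

section \<open>From coherent sets to copies of the transitive tournament\<close>

lemma transitive_tournament_copy:
  assumes "pair_wf_digraph G" "sorted_wrt (\<lambda>x y. (x, y) \<in> parcs G) xs" "distinct xs"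
    and "set xs \<subseteq> pverts G" "length xs = r"
  obtains H where "copy_in (transitive_tournament r) G H" "pverts H = set xs"
proof -
  let ?T = "transitive_tournament r"
  let ?g = "\<lambda>(i, j). (xs ! i, xs ! j)"
  \<comment> \<open>Only the forward arcs are kept, since \<open>G\<close> may also contain backward
    arcs between these vertices.\<close>
  let ?H = "\<lparr>pverts = set xs, parcs = ?g ` parcs ?T\<rparr>"
  let ?f = "\<lparr>iso_verts = \<lambda>i. xs ! i, iso_arcs = ?g, iso_head = snd, iso_tail = fst\<rparr>"
  have wfT: "pair_wf_digraph ?T"
    by unfold_locales (auto simp: transitive_tournament_def)
  have wfH: "pair_wf_digraph ?H"
    using assms(5) by unfold_locales (auto simp: transitive_tournament_def)
  have "subgraph (with_proj ?H) (with_proj G)"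
    using assms wfH unfolding subgraph_def
    by (auto simp: wf_digraph_wp_iff transitive_tournament_def sorted_wrt_iff_nth_less)
  moreover have "pre_digraph.digraph_isomorphism (with_proj ?T) ?f"
    using assms(3,5) wfT unfolding pre_digraph.digraph_isomorphism_def
    by (auto simp: wf_digraph_wp_iff transitive_tournament_def inj_on_def nth_eq_iff_index_eq)
  moreover have "with_proj ?H = app_iso ?f (with_proj ?T)"
    using assms(5) unfolding app_iso_def with_proj_def
    by (auto simp: transitive_tournament_def set_conv_nth)
  ultimately have "copy_in ?T G ?H"
    unfolding copy_in_def digraph_iso_def by blast
  then show thesis by (rule that) simp
qed

lemma (in pair_digraph) out_degree_eq: "out_degree (with_proj G) x = card {v \<in> pverts G. (x, v) \<in> parcs G}"
proof -
  have "out_arcs (with_proj G) x = Pair x ` {v \<in> pverts G. (x, v) \<in> parcs G}"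
    by (auto simp: out_arcs_def dest: in_arcsD2)
  then show ?thesis
    by (simp add: out_degree_def card_image inj_on_def)
qed

lemma (in pair_digraph) in_degree_eq: "in_degree (with_proj G) x = card {v \<in> pverts G. (v, x) \<in> parcs G}"
proof -
  have "in_arcs (with_proj G) x = (\<lambda>v. (v, x)) ` {v \<in> pverts G. (v, x) \<in> parcs G}"
    by (auto simp: in_arcs_def dest: in_arcsD1)
  then show ?thesis
    by (simp add: in_degree_def card_image inj_on_def)
qed

lemma (in pair_digraph) tiling_bounded_leftover:
  fixes \<gamma> :: real
  assumes "r \<ge> 2" "\<gamma> > 0"
    and big: "\<And>x y. \<lbrakk>x \<in> pverts G; y \<in> pverts G; x \<noteq> y\<rbrakk> \<Longrightarrow>
       ((x, y) \<in> parcs G \<and> (y, x) \<in> parcs G) \<or>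
       (\<exists>z\<in>{x, y}. real (dominant_degree G z) \<ge> (1 - 1 / real r + \<gamma>) * real (card (pverts G)))"
  shows "\<exists>\<T>. tiling (transitive_tournament r) G \<T> \<and>
     real (card (pverts G - (\<Union>H\<in>\<T>. pverts H))) \<le> real r * (real r + 1 / \<gamma>)"
proof -
  let ?\<delta> = "(1 - 1 / real r + \<gamma>) * real (card (pverts G))"
  define P where "P = {x. ?\<delta> \<le> real (out_degree (with_proj G) x)}"
  \<comment> \<open>A vertex with both degrees large is assigned to \<open>P\<close> alone.\<close>
  define M where "M = {x. ?\<delta> \<le> real (in_degree (with_proj G) x)} - P"
  have PM: "?\<delta> \<le> real (dominant_degree G x) \<longleftrightarrow> x \<in> P \<union> M" for x
    by (auto simp: P_def M_def dominant_degree_def max_def)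
  have PM_disj: "P \<inter> M = {}"
    by (auto simp: M_def)
  interpret D: dominated_digraph "pverts G" "parcs G" P M r \<gamma>
  proof
    show "(x, x) \<notin> parcs G" for x using no_loops by fastforce
    show "(x, y) \<in> parcs G" if "x \<in> pverts G - (P \<union> M)" "y \<in> pverts G - (P \<union> M)" "x \<noteq> y" for x y
      using big[of x y] that PM by auto
  qed (use assms PM_disj in auto)
  obtain \<K> where "D.partial_tiling \<K>" "\<And>\<L>. D.partial_tiling \<L> \<Longrightarrow> D.weight \<L> \<le> D.weight \<K>"
    using D.heaviest_partial_tiling by blast
  then interpret T: heaviest_tiling "pverts G" "parcs G" P M r \<gamma> \<K>
    by unfold_locales
  have deg: "?\<delta> \<le> real (card (D.N x))" if "x \<in> pverts G \<inter> (P \<union> M)" for x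
  proof (cases "x \<in> P")
    case True
    then have "D.N x = {v \<in> pverts G. (x, v) \<in> parcs G}"
      using PM_disj by (auto simp: D.N_def)
    then show ?thesis using True out_degree_eq by (simp add: P_def)
  next
    case False
    then have "D.N x = {v \<in> pverts G. (v, x) \<in> parcs G}" and "x \<in> M"
      using that by (auto simp: D.N_def)
    then show ?thesis using in_degree_eq by (simp add: M_def)
  qed
  have "\<exists>H. copy_in (transitive_tournament r) G H \<and> pverts H = K" if K: "K \<in> \<K>" "card K = r" for K
  proof -
    obtain xs where xs: "set xs = K" "sorted_wrt D.R xs"
      using T.piece(2)[OF K(1)] by (auto simp: D.coherent_def)
    then have "distinct xs" "sorted_wrt (\<lambda>x y. (x, y) \<in> parcs G) xs"
      using D.sorted_wrt_R_distinct by (auto simp: D.R_def elim: sorted_wrt_mono_rel[rotated])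
    then show ?thesis
      using transitive_tournament_copy[of G xs r] xs(1) K T.piece(1)[OF K(1)]
      by (metis distinct_card pair_wf_digraph_axioms)
  qed
  then obtain h where h: "\<And>K. K \<in> \<K> \<Longrightarrow> card K = r \<Longrightarrow>
      copy_in (transitive_tournament r) G (h K) \<and> pverts (h K) = K"
    by metis
  let ?F = "{K \<in> \<K>. card K = r}"
  have "tiling (transitive_tournament r) G (h ` ?F)"
    unfolding tiling_def using h T.pieces_disjoint by fastforce
  moreover have "(\<Union>H\<in>h ` ?F. pverts H) = \<Union>?F"
    using h by auto
  ultimately show ?thesis
    using T.card_uncovered[OF deg] by metis
qed

theorem theorem6p1:
  fixes r :: nat and \<gamma> :: real
  assumes "r \<ge> 2" and "\<gamma> > 0"
  shows "\<exists>n\<^sub>0::nat. \<forall>n\<ge>n\<^sub>0. \<forall>G::'a pair_pre_digraph.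
    pair_digraph G \<and> card (pverts G) = n \<and>
    (\<forall>x\<in>pverts G. \<forall>y\<in>pverts G. x \<noteq> y \<longrightarrow>
       ((x, y) \<in> parcs G \<and> (y, x) \<in> parcs G) \<or>
       (\<exists>z\<in>{x, y}. real (dominant_degree G z) \<ge> (1 - 1 / real r + \<gamma>) * real n))
    \<longrightarrow> (\<exists>\<T>. tiling (transitive_tournament r) G \<T> \<and>
             real (card (pverts G - (\<Union>H\<in>\<T>. pverts H))) \<le> \<gamma> * real n)"
proof -
  \<comment> \<open>The bound on the number of uncovered vertices does not depend on
    \<open>n\<close>, so \<open>\<gamma> * n\<close> exceeds or equals it from \<open>n0\<close>
    on.\<close>
  obtain n0 :: nat where n0: "real r * (real r + 1 / \<gamma>) / \<gamma> \<le> real n0"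
    using real_arch_simple by blast
  show ?thesis
  proof (intro exI[of _ n0] allI impI, elim conjE)
    fix n and G :: "'a pair_pre_digraph"
    assume n: "n0 \<le> n" and G: "pair_digraph G" "card (pverts G) = n"
      and big: "\<forall>x\<in>pverts G. \<forall>y\<in>pverts G. x \<noteq> y \<longrightarrow>
       ((x, y) \<in> parcs G \<and> (y, x) \<in> parcs G) \<or>
       (\<exists>z\<in>{x, y}. real (dominant_degree G z) \<ge> (1 - 1 / real r + \<gamma>) * real n)"
    have "real r * (real r + 1 / \<gamma>) / \<gamma> \<le> real n"
      using n n0 by simp
    then have bound: "real r * (real r + 1 / \<gamma>) \<le> \<gamma> * real n"
      using assms by (simp add: pos_divide_le_eq mult.commute)
    obtain \<T> where "tiling (transitive_tournament r) G \<T>"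
      "real (card (pverts G - (\<Union>H\<in>\<T>. pverts H))) \<le> real r * (real r + 1 / \<gamma>)"
      using pair_digraph.tiling_bounded_leftover[OF G(1) assms] big G(2) by blast
    then show "\<exists>\<T>. tiling (transitive_tournament r) G \<T> \<and>
        real (card (pverts G - (\<Union>H\<in>\<T>. pverts H))) \<le> \<gamma> * real n"
      using bound by force
  qed
qed

end
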